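(* Let $p$ be an odd prime, let $P_{(p-1)/2}$ be the Legendre polynomial of degree $\frac{p-1}2$, and let $k^2=\varepsilon$. Then $$\left\langle\frac{p^2u^p}{u\,[u]_2[u]_3\cdots[u]_{p-1}[u]_p}\right\rangle_{p-1}\equiv\left\langle\frac1{\sqrt{1-2\delta u^2+\varepsilon u^4}}\right\rangle_{p-1}=k^{\frac{p-1}2}P_{\frac{p-1}2}\!\left(\frac{\delta}k\right)\pmod{p\,\mathbb Z_p[\delta,\varepsilon]},$$ where $[u]_s$ is the $s$-th power in the formal group law of the elliptic genus and $\langle h(u)\rangle_{p-1}$ is the coefficient of $u^{p-1}$ in $h(u)$.
   Context: Let $\delta,\varepsilon$ be indeterminates and let $f(x)=x+\cdots$ be the power series over $\mathbb Q[\delta,\varepsilon]$ with $(f')^2=1-2\delta f^2+\varepsilon f^4$, $f(0)=0$. The formal group law of the elliptic genus is $F(u,v)=f(f^{-1}(u)+f^{-1}(v))$, which has coefficients in $\mathbb Z[\frac12][\delta,\varepsilon]$, and $[u]_s=f(s f^{-1}(u))=su+\cdots$. Legendre polynomials: $\frac1{\sqrt{1-2\delta u+u^2}}=1+\sum_{m>0}P_m(\delta)u^m$. The congruence means that the difference of the two sides, which a priori lies in $\mathbb Q_p[\delta,\varepsilon]$, lies in $p\,\mathbb Z_p[\delta,\varepsilon]$. *)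

theory Defs
  imports
    "HOL-Computational_Algebra.Computational_Algebra"
    "HOL-Number_Theory.Cong"
    "HOL-Algebra.Algebraic_Closure_Type"
begin

hide_const (open) Divisibility.prime

instance fract :: ("{idom, ring_char_0}") field_char_0
proof
  show "inj (of_nat :: nat \<Rightarrow> 'a fract)"
    by (auto intro!: injI simp: of_nat_fract eq_fract)
qed


section \<open>Inverse square roots of formal power series\<close>

definition fps_inv_sqrt :: "'a :: comm_ring_1 fps \<Rightarrow> 'a fps" where
  "fps_inv_sqrt h = (THE g. fps_nth g 0 = 1 \<and> g ^ 2 * h = 1)"

lemma fps_inv_sqrt_ex1:
  fixes h :: "'a :: idom fps"
  assumes c: "2 * c = (1 :: 'a)" and h0: "fps_nth h 0 = 1"
  shows "\<exists>!g. fps_nth g 0 = 1 \<and> g ^ 2 * h = 1"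
proof (rule ex_ex1I)
  define w where "w = fps_right_inverse h 1"
  have hw: "h * w = 1"
    unfolding w_def by (rule fps_right_inverse) (simp add: h0)
  have w0: "fps_nth w 0 = 1"
    by (simp add: w_def)
  define a where "a = wfrec less_than (\<lambda>a n. if n = 0 then 1
      else c * (fps_nth w n - (\<Sum>i\<in>{1..<n}. a i * a (n - i))))"
  have a: "a n = (if n = 0 then 1
      else c * (fps_nth w n - (\<Sum>i\<in>{1..<n}. a i * a (n - i))))" for n
    unfolding a_def
    by (subst wfrec) (auto simp: cut_def intro!: arg_cong[of _ _ "\<lambda>x. c * (_ - x)"] sum.cong)
  define g where "g = Abs_fps a"
  have g0: "fps_nth g 0 = 1"
    by (simp add: g_def a[of 0])
  have "g ^ 2 = w"
  proof (rule fps_ext)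
    fix n
    show "fps_nth (g ^ 2) n = fps_nth w n"
    proof (cases "n = 0")
      case True
      then show ?thesis by (simp add: g0 w0 power2_eq_square)
    next
      case False
      then have "{0..n} = insert 0 (insert n {1..<n})"
        by auto
      then have "fps_nth (g ^ 2) n = 2 * a n + (\<Sum>i\<in>{1..<n}. a i * a (n - i))"
        using False by (simp add: power2_eq_square fps_mult_nth g_def a[of 0])
      also have "2 * a n = (2 * c) * (fps_nth w n - (\<Sum>i\<in>{1..<n}. a i * a (n - i)))"
        using False by (subst a) (simp add: mult.assoc)
      finally show ?thesis
        by (simp add: c)
    qed
  qed
  with g0 hw show "\<exists>g. fps_nth g 0 = 1 \<and> g ^ 2 * h = 1"
    by (auto simp: mult.commute intro!: exI[of _ g])
next
  fix g g' :: "'a fps"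
  assume g: "fps_nth g 0 = 1 \<and> g ^ 2 * h = 1" and g': "fps_nth g' 0 = 1 \<and> g' ^ 2 * h = 1"
  have "h \<noteq> 0"
    using h0 by auto
  with g g' have "g ^ 2 = g' ^ 2"
    by (metis mult_cancel_right)
  then have "g = g' \<or> g = - g'"
    by (simp add: power2_eq_iff)
  moreover have "g \<noteq> - g'"
  proof
    assume "g = - g'"
    then have "(1 :: 'a) = - 1"
      using g g' by (metis fps_neg_nth)
    then have "(2 :: 'a) = 0"
      by (metis add.right_inverse one_add_one)
    with c show False
      by simp
  qed
  ultimately show "g = g'"
    by simp
qed


section \<open>Legendre polynomials\<close>

definition legendre :: "nat \<Rightarrow> rat poly" where
  "legendre m =
     fps_nth (fps_inv_sqrt (1 - fps_const [:0, 2:] * fps_X + fps_X ^ 2)) m"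


section \<open>The formal group law of the elliptic genus\<close>

text \<open>
  \<^typ>\<open>rat poly poly\<close> is the ring of polynomials over the rationals in the two
  indeterminates \<open>\<delta>\<close> (inner variable) and \<open>\<epsilon>\<close> (outer variable).
\<close>

definition delta :: "rat poly poly" where
  "delta = [:[:0, 1:]:]"

definition epsilon :: "rat poly poly" where
  "epsilon = [:0, 1:]"

definition ell_f :: "rat poly poly fps" where
  "ell_f = (THE f. fps_nth f 0 = 0 \<and> fps_nth f 1 = 1 \<and>
     fps_deriv f ^ 2 = 1 - fps_const (2 * delta) * f ^ 2 + fps_const epsilon * f ^ 4)"

lemma ell_f_second_order:
  fixes f :: "rat poly poly fps"
  assumes "fps_nth f 1 = 1"
    and "fps_deriv f ^ 2 = 1 - fps_const (2 * delta) * f ^ 2 + fps_const epsilon * f ^ 4"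
  shows "fps_deriv (fps_deriv f) =
           - fps_const (2 * delta) * f + fps_const (2 * epsilon) * f ^ 3"
proof -
  let ?f' = "fps_deriv f"
  have "fps_deriv (?f' ^ 2) =
      fps_deriv (1 - fps_const (2 * delta) * f ^ 2 + fps_const epsilon * f ^ 4)"
    using assms(2) by simp
  then have "2 * ?f' * fps_deriv ?f' =
      - fps_const (2 * delta) * (2 * f * ?f') + fps_const epsilon * (4 * f ^ 3 * ?f')"
    by (simp add: fps_deriv_power power2_eq_square eval_nat_numeral algebra_simps
        del: fps_const_neg)
  then have "(2 * ?f') * fps_deriv ?f' = (2 * ?f') *
      (- fps_const (2 * delta) * f + 2 * fps_const epsilon * f ^ 3)"
    by (simp add: algebra_simps del: fps_const_neg)
  moreover have "2 * ?f' \<noteq> 0"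
  proof -
    have "fps_nth ?f' 0 = 1"
      using assms(1) by simp
    then have "?f' \<noteq> 0"
      by (metis fps_zero_nth zero_neq_one)
    then show ?thesis by simp
  qed
  ultimately have "fps_deriv ?f' = - fps_const (2 * delta) * f + 2 * fps_const epsilon * f ^ 3"
    using mult_left_cancel by blast
  also have "2 * fps_const epsilon = fps_const (2 * epsilon)"
    by (metis fps_const_mult fps_numeral_fps_const)
  finally show ?thesis .
qed

lemma fps_mult_agree:
  assumes "\<forall>i\<le>m. fps_nth s i = fps_nth t i" "\<forall>i\<le>m. fps_nth s' i = fps_nth t' i"
  shows "\<forall>i\<le>m. fps_nth (s * s') i = fps_nth (t * t') i"
  using assms by (auto simp: fps_mult_nth intro!: sum.cong)

lemma ell_rhs_agree:
  fixes s t :: "rat poly poly fps"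
  assumes "\<And>i. i \<le> m \<Longrightarrow> fps_nth s i = fps_nth t i"
  shows "fps_nth (- fps_const (2 * delta) * s + fps_const (2 * epsilon) * s ^ 3) m =
         fps_nth (- fps_const (2 * delta) * t + fps_const (2 * epsilon) * t ^ 3) m"
proof -
  have "\<forall>i\<le>m. fps_nth s i = fps_nth t i"
    using assms by blast
  then have "\<forall>i\<le>m. fps_nth (s * s * s) i = fps_nth (t * t * t) i"
    by (intro fps_mult_agree)
  with assms show ?thesis
    by (simp add: power3_eq_cube fps_mult_left_const_nth flip: fps_const_neg)
qed

lemma ell_f_ex1:
  "\<exists>!f :: rat poly poly fps. fps_nth f 0 = 0 \<and> fps_nth f 1 = 1 \<and>
     fps_deriv f ^ 2 = 1 - fps_const (2 * delta) * f ^ 2 + fps_const epsilon * f ^ 4"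
proof (rule ex_ex1I)
  define R where "R = (\<lambda>t :: rat poly poly fps.
      - fps_const (2 * delta) * t + fps_const (2 * epsilon) * t ^ 3)"
  define c where "c = (\<lambda>n. [:[:1 / of_nat n:]:] :: rat poly poly)"
  have c: "of_nat n * c n = 1" if "n > 0" for n
    using that by (simp add: c_def of_nat_poly one_pCons)
  define H where "H = (\<lambda>a n. if n < 2 then of_nat n
      else c n * c (n - 1) * fps_nth (R (Abs_fps (\<lambda>i. if i \<le> n - 2 then a i else 0))) (n - 2))"
  have H: "H s n = H t n" if "\<And>i. i < n \<Longrightarrow> s i = t i" for s t n
  proof (cases "n < 2")
    case False
    then have "fps_nth (R (Abs_fps (\<lambda>i. if i \<le> n - 2 then s i else 0))) (n - 2) =
               fps_nth (R (Abs_fps (\<lambda>i. if i \<le> n - 2 then t i else 0))) (n - 2)"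
      unfolding R_def by (intro ell_rhs_agree) (simp add: that)
    with False show ?thesis
      by (simp only: H_def)
  qed (simp add: H_def)
  define a where "a = wfrec less_than H"
  have "a n = H a n" for n
    unfolding a_def by (subst wfrec) (auto simp: cut_def intro!: H)
  then have a: "a n = (if n < 2 then of_nat n
      else c n * c (n - 1) * fps_nth (R (Abs_fps (\<lambda>i. if i \<le> n - 2 then a i else 0))) (n - 2))" for n
    unfolding H_def .
  define f where "f = Abs_fps a"
  have f01: "fps_nth f 0 = 0" "fps_nth f 1 = 1"
    by (simp_all add: f_def a[of 0] a[of "Suc 0"])
  have f2: "fps_deriv (fps_deriv f) = R f"
  proof (rule fps_ext)
    fix m
    have "a (m + 2) = c (m + 2) * c (m + 1) * fps_nth (R f) m"
    proof (subst a)
      have "fps_nth (R (Abs_fps (\<lambda>i. if i \<le> m then a i else 0))) m = fps_nth (R f) m"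
        unfolding R_def by (rule ell_rhs_agree) (simp add: f_def)
      then show "(if m + 2 < 2 then of_nat (m + 2)
          else c (m + 2) * c (m + 2 - 1) *
            fps_nth (R (Abs_fps (\<lambda>i. if i \<le> m + 2 - 2 then a i else 0))) (m + 2 - 2)) =
          c (m + 2) * c (m + 1) * fps_nth (R f) m"
        by simp
    qed
    then have "of_nat (m + 1) * (of_nat (m + 2) * a (m + 2)) =
        (of_nat (m + 1) * c (m + 1)) * (of_nat (m + 2) * c (m + 2)) * fps_nth (R f) m"
      by (simp only: ac_simps)
    also have "\<dots> = fps_nth (R f) m"
      by (subst c, simp, subst c, simp, simp)
    finally show "fps_nth (fps_deriv (fps_deriv f)) m = fps_nth (R f) m"
      by (simp add: f_def algebra_simps)
  qed
  define E where "E = fps_deriv f ^ 2 - (1 - fps_const (2 * delta) * f ^ 2 + fps_const epsilon * f ^ 4)"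
  have "2 * fps_const epsilon = fps_const (2 * epsilon)"
    by (metis fps_const_mult fps_numeral_fps_const)
  then have R: "R f = - fps_const (2 * delta) * f + 2 * fps_const epsilon * f ^ 3"
    by (simp add: R_def)
  have "fps_deriv E = 2 * fps_deriv f * (fps_deriv (fps_deriv f) - R f)"
    unfolding E_def R
    by (simp add: fps_deriv_power power2_eq_square eval_nat_numeral algebra_simps
        del: fps_const_neg)
  then have "E = fps_const (fps_nth E 0)"
    using f2 by (simp flip: fps_deriv_eq_0_iff)
  also have "fps_nth E 0 = 0"
    using f01 by (simp add: E_def fps_nth_power_0)
  finally show "\<exists>f :: rat poly poly fps. fps_nth f 0 = 0 \<and> fps_nth f 1 = 1 \<and>
     fps_deriv f ^ 2 = 1 - fps_const (2 * delta) * f ^ 2 + fps_const epsilon * f ^ 4"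
    using f01 by (intro exI[of _ f]) (simp add: E_def)
next
  fix f g :: "rat poly poly fps"
  assume f: "fps_nth f 0 = 0 \<and> fps_nth f 1 = 1 \<and>
     fps_deriv f ^ 2 = 1 - fps_const (2 * delta) * f ^ 2 + fps_const epsilon * f ^ 4"
  assume g: "fps_nth g 0 = 0 \<and> fps_nth g 1 = 1 \<and>
     fps_deriv g ^ 2 = 1 - fps_const (2 * delta) * g ^ 2 + fps_const epsilon * g ^ 4"
  have "fps_nth f n = fps_nth g n" for n
  proof (induction n rule: less_induct)
    case (less n)
    consider "n = 0" | "n = 1" | m where "n = m + 2"
      by (metis One_nat_def Suc_1 add.commute add_2_eq_Suc not0_implies_Suc)
    then show ?case
    proof cases
      case 3
      have "fps_nth (fps_deriv (fps_deriv f)) m = fps_nth (fps_deriv (fps_deriv g)) m"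
        using f g less 3 by (simp only: ell_f_second_order) (rule ell_rhs_agree, simp)
      then have "of_nat (m + 1) * of_nat (m + 2) * fps_nth f n =
                 of_nat (m + 1) * of_nat (m + 2) * fps_nth g n"
        using 3 by (simp add: algebra_simps)
      moreover have "of_nat (m + 1) * of_nat (m + 2) \<noteq> (0 :: rat poly poly)"
        by (simp del: of_nat_add of_nat_Suc)
      ultimately show ?thesis
        using mult_left_cancel by blast
    qed (use f g in auto)
  qed
  then show "f = g"
    by (rule fps_ext)
qed

text \<open>
  Quotients of power series need a field of coefficients; we pass to the field of fractions
  of the polynomial ring.
\<close>

definition fps_to_fract :: "'a :: idom fps \<Rightarrow> 'a fract fps" where
  "fps_to_fract h = Abs_fps (\<lambda>n. to_fract (fps_nth h n))"

definition ell_power :: "nat \<Rightarrow> rat poly poly fract fps" where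
  "ell_power s =
     fps_to_fract ell_f oo (of_nat s * fps_inv (fps_to_fract ell_f))"


section \<open>Congruence modulo p over the p-adic integers\<close>

text \<open>The inverse limit of the rings of integers modulo \<open>p ^ n\<close>.\<close>

definition padic_ints :: "nat \<Rightarrow> (nat \<Rightarrow> int) set" where
  "padic_ints p = {x. \<forall>n. x n \<in> {0..<int p ^ n} \<and> [x (Suc n) = x n] (mod int p ^ n)}"

text \<open>
  The rational numbers that lie in \<open>p\<close> times the \<open>p\<close>-adic integers, inside the field of
  fractions of the \<open>p\<close>-adic integers: \<open>a / b = p z\<close> there means \<open>a = b p z\<close>, that is,
  equality modulo every \<open>p ^ n\<close>.
\<close>

definition p_padic_rats :: "nat \<Rightarrow> rat set" where
  "p_padic_rats p = {c. \<exists>z\<in>padic_ints p. \<forall>n.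
     [fst (quotient_of c) = snd (quotient_of c) * int p * z n] (mod int p ^ n)}"

lemma p_padic_rats_iff:
  assumes p: "prime p"
  shows "c \<in> p_padic_rats p \<longleftrightarrow>
    (\<exists>a b. \<not> int p dvd b \<and> c = of_nat p * of_int a / of_int b)"
proof -
  obtain a0 b0 where q: "quotient_of c = (a0, b0)"
    by (cases "quotient_of c")
  have c: "c = of_int a0 / of_int b0" and b0: "b0 > 0" and cop: "coprime a0 b0"
    using q quotient_of_div quotient_of_denom_pos quotient_of_coprime by blast+
  have ip: "prime (int p)"
    using p by simp
  have notdvd: "\<not> int p dvd b0" if "int p dvd a0"
    using that cop ip by (meson coprime_common_divisor not_prime_unit)
  show ?thesis
  proof
    assume "c \<in> p_padic_rats p"
    then obtain z where z: "\<And>n. [a0 = b0 * int p * z n] (mod int p ^ n)"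
      by (auto simp: p_padic_rats_def q)
    have "int p dvd a0"
      using z[of 1] by (simp add: cong_dvd_iff)
    then obtain a where "a0 = int p * a"
      by (elim dvdE)
    then show "\<exists>a b. \<not> int p dvd b \<and> c = of_nat p * of_int a / of_int b"
      using notdvd c by (intro exI[of _ a] exI[of _ b0]) auto
  next
    assume "\<exists>a b. \<not> int p dvd b \<and> c = of_nat p * of_int a / of_int b"
    then obtain a b where b: "\<not> int p dvd b" and cab: "c = of_nat p * of_int a / of_int b"
      by blast
    have "b \<noteq> 0"
      using b by auto
    with c cab b0 have "(of_int (a0 * b) :: rat) = of_int (int p * a * b0)"
      by (simp add: field_simps)
    then have "a0 * b = int p * a * b0"
      by (simp only: of_int_eq_iff)
    then have "int p dvd a0 * b"
      by simp
    then have "int p dvd a0"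
      using b ip by (simp add: prime_dvd_mult_iff)
    then obtain a1 where a1: "a0 = int p * a1" and "\<not> int p dvd b0"
      using notdvd by (meson dvdE)
    then have copn: "coprime b0 (int p ^ n)" for n
      using ip by (metis coprime_commute coprime_power_right_iff prime_imp_coprime)
    have "\<exists>y. [b0 * y = 1] (mod int p ^ n)" for n
      using copn by (rule cong_solve_coprime_int)
    then obtain y where y: "\<And>n. [b0 * y n = 1] (mod int p ^ n)"
      by metis
    define z where "z = (\<lambda>n. (y n * a1) mod int p ^ n)"
    have z: "[b0 * z n = a1] (mod int p ^ n)" for n
    proof -
      have "[b0 * z n = b0 * (y n * a1)] (mod int p ^ n)"
        unfolding z_def by (intro cong_mult cong_refl) (simp add: cong_def)
      also have "[b0 * (y n * a1) = a1] (mod int p ^ n)"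
        using cong_mult[OF y[of n] cong_refl[of a1]] by (simp add: mult.assoc)
      finally show ?thesis .
    qed
    have "z \<in> padic_ints p"
    proof -
      have "[z (Suc n) = z n] (mod int p ^ n)" for n
      proof -
        have "[b0 * z (Suc n) = a1] (mod int p ^ n)"
          using z[of "Suc n"] by (rule cong_dvd_modulus) simp
        with z[of n] have "[b0 * z (Suc n) = b0 * z n] (mod int p ^ n)"
          by (meson cong_sym cong_trans)
        then show ?thesis
          using copn by (simp add: cong_mult_lcancel)
      qed
      moreover have "int p > 0"
        using p by (simp add: prime_gt_0_nat)
      ultimately show ?thesis
        by (simp add: padic_ints_def z_def)
    qed
    moreover have "[a0 = b0 * int p * z n] (mod int p ^ n)" for n
      using cong_mult[OF cong_refl[of "int p"] cong_sym[OF z[of n]]]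
      by (simp add: a1 ac_simps)
    ultimately show "c \<in> p_padic_rats p"
      by (auto simp: p_padic_rats_def q)
  qed
qed

text \<open>
  The polynomials in \<open>\<delta>\<close> and \<open>\<epsilon>\<close> with rational coefficients that have all their
  coefficients in \<open>p\<close> times the \<open>p\<close>-adic integers.
\<close>

definition p_padic_polys :: "nat \<Rightarrow> rat poly poly fract set" where
  "p_padic_polys p =
     {to_fract d | d. \<forall>i j. coeff (coeff d i) j \<in> p_padic_rats p}"

end

theory Submission
  imports Defs "HOL-Number_Theory.Residues"
begin

text \<open>
  Write \<open>g\<close> for the inverse series of \<open>f\<close>, so that \<open>[u]\<^sub>s = f (s g(u))\<close> and \<open>w = g'\<close> is the inverse
  square root of the quartic; \<open>w\<close> is \<open>p\<close>-integral because \<open>2\<close> is a unit. The differential equation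
  gives \<open>n (n - 1) f\<^sub>n\<close> in terms of earlier coefficients, so \<open>f\<^sub>n\<close> is \<open>p\<close>-integral for \<open>n < p\<close> and
  \<open>p f\<^sub>p\<close> is as well. Only the coefficients of \<open>[u]\<^sub>s\<close> up to degree \<open>p\<close> matter, and these bounds suffice
  to see that they are \<open>p\<close>-integral, and that \<open>[u]\<^sub>p / u = p A(u) + h u\<^sup>p\<^sup>-\<^sup>1 + \<dots>\<close> with \<open>A\<close> integral,
  \<open>A(0) = 1\<close>, where \<open>h\<close> is congruent modulo \<open>p\<close> to \<open>p g\<^sub>p = w\<^sub>p\<^sub>-\<^sub>1\<close>. Hence \<open>p\<^sup>2 u / [u]\<^sub>p\<close> is
  \<open>p / A - h u\<^sup>p\<^sup>-\<^sup>1 + \<dots>\<close>, so the coefficient of the whole quotient is congruent to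
  \<open>- h / (p - 1)!\<close>, which is congruent to \<open>h\<close> by Wilson's theorem.

  The Legendre form follows by substituting \<open>k u\<^sup>2\<close> into the generating function at \<open>\<delta> / k\<close>.
\<close>


section \<open>Coefficientwise homomorphisms\<close>

definition fps_map :: "('a \<Rightarrow> 'b) \<Rightarrow> 'a fps \<Rightarrow> 'b fps" where
  "fps_map \<phi> h = Abs_fps (\<lambda>n. \<phi> (fps_nth h n))"

lemma fps_map_nth [simp]: "fps_nth (fps_map \<phi> h) n = \<phi> (fps_nth h n)"
  by (simp add: fps_map_def)

text \<open>Applied below to \<open>to_fract\<close>, \<open>to_ac\<close> and the evaluation of a
  rational polynomial at a point.\<close>

locale comm_ring_hom_fun =
  fixes \<phi> :: "'a :: comm_ring_1 \<Rightarrow> 'b :: comm_ring_1"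
  assumes hom_1: "\<phi> 1 = 1"
    and hom_add: "\<phi> (x + y) = \<phi> x + \<phi> y"
    and hom_mult: "\<phi> (x * y) = \<phi> x * \<phi> y"
begin

lemma hom_0: "\<phi> 0 = 0"
  using hom_add[of 0 0] by simp

lemma hom_uminus: "\<phi> (- x) = - \<phi> x"
  using hom_add[of x "- x"] by (simp add: hom_0 eq_neg_iff_add_eq_0 add.commute)

lemma hom_diff: "\<phi> (x - y) = \<phi> x - \<phi> y"
  using hom_add[of x "- y"] by (simp add: hom_uminus)

lemma hom_sum: "\<phi> (sum t A) = (\<Sum>x\<in>A. \<phi> (t x))"
  by (induction A rule: infinite_finite_induct) (simp_all add: hom_0 hom_add)

lemma hom_of_nat: "\<phi> (of_nat n) = of_nat n"
  by (induction n) (simp_all add: hom_0 hom_1 hom_add)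

lemma fps_map_1: "fps_map \<phi> 1 = 1"
  by (rule fps_ext) (simp add: hom_0 hom_1)

lemma fps_map_X: "fps_map \<phi> fps_X = fps_X"
  by (rule fps_ext) (simp add: fps_X_def hom_0 hom_1)

lemma fps_map_const: "fps_map \<phi> (fps_const c) = fps_const (\<phi> c)"
  by (rule fps_ext) (simp add: hom_0)

lemma fps_map_add: "fps_map \<phi> (s + t) = fps_map \<phi> s + fps_map \<phi> t"
  by (rule fps_ext) (simp add: hom_add)

lemma fps_map_diff: "fps_map \<phi> (s - t) = fps_map \<phi> s - fps_map \<phi> t"
  by (rule fps_ext) (simp add: hom_diff)

lemma fps_map_mult: "fps_map \<phi> (s * t) = fps_map \<phi> s * fps_map \<phi> t"
  by (rule fps_ext) (simp add: fps_mult_nth hom_sum hom_mult)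

lemma fps_map_power: "fps_map \<phi> (s ^ n) = fps_map \<phi> s ^ n"
  by (induction n) (simp_all add: fps_map_1 fps_map_mult)

lemma fps_map_deriv: "fps_map \<phi> (fps_deriv s) = fps_deriv (fps_map \<phi> s)"
  using hom_of_nat by (intro fps_ext) (simp add: hom_mult hom_add hom_1)

lemmas fps_map_simps = fps_map_1 fps_map_X fps_map_const fps_map_add fps_map_diff
  fps_map_mult fps_map_power fps_map_deriv

end

section \<open>Inverse square roots and coefficient homomorphisms\<close>

lemma fps_inv_sqrt_eqI:
  fixes g h :: "'a :: idom fps"
  assumes "2 * c = (1 :: 'a)" "fps_nth h 0 = 1" "fps_nth g 0 = 1" "g ^ 2 * h = 1"
  shows "fps_inv_sqrt h = g"
  unfolding fps_inv_sqrt_def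
  using fps_inv_sqrt_ex1[OF assms(1,2)] assms(3,4) by (intro the1_equality) auto

lemma fps_inv_sqrt:
  fixes h :: "'a :: idom fps"
  assumes "2 * c = (1 :: 'a)" "fps_nth h 0 = 1"
  shows "fps_nth (fps_inv_sqrt h) 0 = 1" "fps_inv_sqrt h ^ 2 * h = 1"
  using theI'[OF fps_inv_sqrt_ex1[OF assms]] by (simp_all add: fps_inv_sqrt_def)

text \<open>The image still has constant term 1 and satisfies the mapped defining equation;
  uniqueness does the rest.\<close>

lemma fps_map_inv_sqrt:
  fixes \<phi> :: "'a :: idom \<Rightarrow> 'b :: idom" and c :: 'a
  assumes "comm_ring_hom_fun \<phi>" and c: "2 * c = 1" "fps_nth h 0 = 1"
  shows "fps_map \<phi> (fps_inv_sqrt h) = fps_inv_sqrt (fps_map \<phi> h)"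
proof -
  interpret comm_ring_hom_fun \<phi> by fact
  have "2 * \<phi> c = 1"
    using arg_cong[OF c(1), of \<phi>] hom_of_nat[of 2] by (simp add: hom_mult hom_1)
  moreover have "fps_map \<phi> (fps_inv_sqrt h) ^ 2 * fps_map \<phi> h = 1"
    using arg_cong[OF fps_inv_sqrt(2)[OF c], of "fps_map \<phi>"] by (simp add: fps_map_simps)
  ultimately show ?thesis
    using c fps_inv_sqrt(1)[OF c] by (intro fps_inv_sqrt_eqI[symmetric]) (simp_all add: hom_1)
qed

lemma comm_ring_hom_fun_to_fract: "comm_ring_hom_fun to_fract"
  by unfold_locales simp_all

lemma comm_ring_hom_fun_to_ac: "comm_ring_hom_fun to_ac"
  by unfold_locales simp_all

lemma comm_ring_hom_fun_poly_of_rat: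
  "comm_ring_hom_fun (\<lambda>q. poly (map_poly of_rat q) (t :: 'a :: field_char_0))"
proof
  fix x y :: "rat poly"
  have "map_poly of_rat (x + y) = map_poly of_rat x + (map_poly of_rat y :: 'a poly)"
    by (rule poly_eqI) (simp add: coeff_map_poly of_rat_add)
  then show "poly (map_poly of_rat (x + y)) t = poly (map_poly of_rat x) t + poly (map_poly of_rat y) t"
    by simp
  have "map_poly of_rat (x * y) = map_poly of_rat x * (map_poly of_rat y :: 'a poly)"
    by (rule poly_eqI) (simp add: coeff_map_poly coeff_mult of_rat_sum of_rat_mult)
  then show "poly (map_poly of_rat (x * y)) t = poly (map_poly of_rat x) t * poly (map_poly of_rat y) t"
    by simp
qed (simp add: map_poly_1)


section \<open>Legendre polynomials and the quartic\<close>

lemma fps_inv_sqrt_compose: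
  fixes h c :: "'a :: field_char_0 fps"
  assumes "fps_nth c 0 = 0" "fps_nth h 0 = 1"
  shows "fps_inv_sqrt h oo c = fps_inv_sqrt (h oo c)"
proof (rule fps_inv_sqrt_eqI[symmetric, where c = "1 / 2"])
  note s = fps_inv_sqrt[of "1 / 2" h, OF _ assms(2)]
  show "fps_nth (fps_inv_sqrt h oo c) 0 = 1"
    using s by simp
  have "(fps_inv_sqrt h ^ 2 * h) oo c = 1"
    using s by simp
  then show "(fps_inv_sqrt h oo c) ^ 2 * (h oo c) = 1"
    using assms by (simp add: fps_compose_mult_distrib fps_compose_power)
qed (use assms in simp_all)

lemma fps_inv_sqrt_quartic_nth:
  fixes k d :: "'a :: field_char_0"
  assumes "k \<noteq> 0"
  shows "fps_nth (fps_inv_sqrt (1 - fps_const (2 * d) * fps_X ^ 2 + fps_const (k ^ 2) * fps_X ^ 4)) (2 * m)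
    = k ^ m * poly (map_poly of_rat (legendre m)) (d / k)"
proof -
  define \<phi> where "\<phi> = (\<lambda>q. poly (map_poly of_rat q) (d / k))"
  interpret comm_ring_hom_fun \<phi>
    unfolding \<phi>_def by (rule comm_ring_hom_fun_poly_of_rat)
  let ?L = "1 - fps_const [:0, 2:] * fps_X + fps_X ^ 2 :: rat poly fps"
  let ?c = "fps_const k * fps_X ^ 2 :: 'a fps"
  have \<phi>: "\<phi> [:0, 2:] = 2 * (d / k)"
    by (simp add: \<phi>_def map_poly_pCons)
  have two: "2 * [:1 / 2:] = (1 :: rat poly)"
    by (simp add: numeral_poly one_pCons)
  have L: "fps_map \<phi> ?L = 1 - fps_const (2 * (d / k)) * fps_X + fps_X ^ 2"
    by (simp only: fps_map_simps \<phi>)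
  have "fps_map \<phi> (fps_inv_sqrt ?L) oo ?c = fps_inv_sqrt (fps_map \<phi> ?L) oo ?c"
    by (subst fps_map_inv_sqrt[OF comm_ring_hom_fun_axioms two]) simp_all
  also have "\<dots> = fps_inv_sqrt (fps_map \<phi> ?L oo ?c)"
    unfolding L by (rule fps_inv_sqrt_compose) simp_all
  \<comment> \<open>With \<open>k u^2\<close> in place of \<open>u\<close>, the factor
    \<open>k\<close> cancels against \<open>d / k\<close> in the middle term and the square gives
    \<open>k^2 u^4\<close>.\<close>
  also have "fps_map \<phi> ?L oo ?c = 1 - fps_const (2 * (d / k)) * ?c + ?c ^ 2"
    unfolding L
    by (simp add: fps_compose_add_distrib fps_compose_sub_distrib fps_compose_mult_distrib
        flip: fps_compose_power)
  also have "\<dots> = 1 - fps_const (2 * d) * fps_X ^ 2 + fps_const (k ^ 2) * fps_X ^ 4"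
    using assms by (simp add: power_mult_distrib flip: mult.assoc power_mult)
  finally have eq: "fps_inv_sqrt (1 - fps_const (2 * d) * fps_X ^ 2 + fps_const (k ^ 2) * fps_X ^ 4)
      = fps_map \<phi> (fps_inv_sqrt ?L) oo ?c" by simp
  \<comment> \<open>Only the \<open>m\<close>-th power of \<open>k u^2\<close> has a term of degree
    \<open>2 * m\<close>.\<close>
  have "fps_nth (?c ^ i) (2 * m) = (if i = m then k ^ m else 0)" for i
    by (simp add: power_mult_distrib fps_X_power_nth flip: power_mult)
  then have "fps_nth (fps_map \<phi> (fps_inv_sqrt ?L) oo ?c) (2 * m) = \<phi> (legendre m) * k ^ m"
    unfolding fps_compose_nth legendre_def by (simp add: if_distrib[of "(*) _"] cong: if_cong)
  then show ?thesis
    by (simp add: eq \<phi>_def)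
qed


section \<open>Subrings\<close>

text \<open>Integrality is membership in a set, so that fractions can be formed in an ambient field
  and shown integral afterwards.\<close>

locale subring_set =
  fixes S :: "'a :: comm_ring_1 set"
  assumes one_mem: "1 \<in> S"
    and add_mem: "x \<in> S \<Longrightarrow> y \<in> S \<Longrightarrow> x + y \<in> S"
    and uminus_mem: "x \<in> S \<Longrightarrow> - x \<in> S"
    and mult_mem: "x \<in> S \<Longrightarrow> y \<in> S \<Longrightarrow> x * y \<in> S"
begin

lemma zero_mem: "0 \<in> S"
  using add_mem[OF one_mem uminus_mem[OF one_mem]] by simp

lemma diff_mem: "x \<in> S \<Longrightarrow> y \<in> S \<Longrightarrow> x - y \<in> S"
  using add_mem[OF _ uminus_mem] by fastforce

lemma sum_mem: "(\<And>x. x \<in> A \<Longrightarrow> t x \<in> S) \<Longrightarrow> sum t A \<in> S"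
  by (induction A rule: infinite_finite_induct) (auto intro: zero_mem add_mem)

lemma power_mem: "x \<in> S \<Longrightarrow> x ^ n \<in> S"
  by (induction n) (auto intro: one_mem mult_mem)

lemma of_nat_mem: "of_nat n \<in> S"
  by (induction n) (auto intro: zero_mem one_mem add_mem)

text \<open>The degree bound is there because integrality of \<open>f\<close> and \<open>g\<close>
  is known only below degree \<open>p\<close>; products respect it, since degree \<open>i\<close> of
  a product involves no higher degrees of the factors.\<close>

definition integral_upto :: "nat \<Rightarrow> 'a fps \<Rightarrow> bool" where
  "integral_upto n h \<longleftrightarrow> (\<forall>i\<le>n. fps_nth h i \<in> S)"

lemma integral_upto_mult:
  "integral_upto n s \<Longrightarrow> integral_upto n t \<Longrightarrow> integral_upto n (s * t)"
  by (auto simp: integral_upto_def fps_mult_nth intro!: sum_mem mult_mem)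

lemma integral_upto_1: "integral_upto n 1"
  by (auto simp: integral_upto_def intro: zero_mem one_mem)

lemma integral_upto_power: "integral_upto n s \<Longrightarrow> integral_upto n (s ^ i)"
  by (induction i) (auto intro: integral_upto_1 integral_upto_mult)

lemma integral_upto_prod:
  "(\<And>x. x \<in> A \<Longrightarrow> integral_upto n (t x)) \<Longrightarrow> integral_upto n (prod t A)"
  by (induction A rule: infinite_finite_induct) (auto intro: integral_upto_1 integral_upto_mult)

lemma subring_set_poly: "subring_set {q. \<forall>i. coeff q i \<in> S}"
proof
  show "1 \<in> {q. \<forall>i. coeff q i \<in> S}"
    by (auto simp: one_pCons coeff_pCons zero_mem one_mem split: nat.split)
qed (auto simp: coeff_mult intro: add_mem uminus_mem mult_mem sum_mem)

lemma subring_set_image: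
  assumes "comm_ring_hom_fun \<phi>"
  shows "subring_set (\<phi> ` S)"
proof -
  interpret comm_ring_hom_fun \<phi> by fact
  show ?thesis
    by unfold_locales
      (auto simp flip: hom_1 hom_add hom_uminus hom_mult
        intro: one_mem add_mem uminus_mem mult_mem)
qed

end

lemma fps_prod_nth_0: "fps_nth (prod t A) 0 = (\<Prod>x\<in>A. fps_nth (t x) 0)"
  by (induction A rule: infinite_finite_induct) simp_all

lemma fps_inverse_nth_rec:
  fixes h :: "'a :: field fps"
  assumes "fps_nth h 0 \<noteq> 0" "n > 0"
  shows "fps_nth (inverse h) n
    = - (inverse (fps_nth h 0) * (\<Sum>i=1..n. fps_nth h i * fps_nth (inverse h) (n - i)))"
proof -
  have "fps_nth (h * inverse h) n = 0"
    using assms by (simp add: inverse_mult_eq_1')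
  moreover have "{0..n} = insert 0 {1..n}"
    by auto
  ultimately have "fps_nth h 0 * fps_nth (inverse h) n
      = - (\<Sum>i=1..n. fps_nth h i * fps_nth (inverse h) (n - i))"
    by (simp add: fps_mult_nth eq_neg_iff_add_eq_0)
  then show ?thesis
    using assms by (simp add: field_simps)
qed

text \<open>An abstract form of localisation at \<open>p\<close>: the integers prime to
  \<open>p\<close> become units of \<open>S\<close>.\<close>

locale p_integral = subring_set S for S :: "'a :: field_char_0 set" +
  fixes p :: nat
  assumes prime_p: "prime p" and odd_p: "odd p"
    and inverse_of_nat_mem: "\<not> p dvd n \<Longrightarrow> inverse (of_nat n) \<in> S"
begin

lemma p_gt_2: "p > 2"
  using prime_p odd_p prime_gt_1_nat[of p] by (cases "p = 2") auto

lemma not_dvd_less: "0 < n \<Longrightarrow> n < p \<Longrightarrow> \<not> p dvd n"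
  using nat_dvd_not_less by blast

lemma of_nat_mult_mem_cancel:
  assumes "of_nat n * x \<in> S" "\<not> p dvd n"
  shows "x \<in> S"
proof -
  have "n \<noteq> 0"
    using assms(2) by (metis dvd_0_right)
  then have "inverse (of_nat n) * (of_nat n * x) = x"
    by (simp flip: mult.assoc)
  then show ?thesis
    using mult_mem[OF inverse_of_nat_mem[OF assms(2)] assms(1)] by metis
qed

lemma integral_upto_inverse:
  assumes "fps_nth h 0 \<noteq> 0" "inverse (fps_nth h 0) \<in> S" "integral_upto n h"
  shows "integral_upto n (inverse h)"
proof -
  have "i \<le> n \<longrightarrow> fps_nth (inverse h) i \<in> S" for i
  proof (induction i rule: less_induct)
    case (less i)
    show ?case
    proof (cases "i = 0")
      case False
      with less assms show ?thesis
        by (auto simp: fps_inverse_nth_rec integral_upto_def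
            intro!: uminus_mem mult_mem sum_mem)
    qed (use assms in simp)
  qed
  then show ?thesis
    by (simp add: integral_upto_def)
qed

text \<open>The ideal of \<open>S\<close> generated by \<open>p\<close>; congruence modulo
  \<open>p\<close> means that the difference lies in it.\<close>

definition pS :: "'a set" where
  "pS = (*) (of_nat p) ` S"

lemma p_mult_pS: "x \<in> S \<Longrightarrow> of_nat p * x \<in> pS"
  by (auto simp: pS_def)

lemma pS_add: "x \<in> pS \<Longrightarrow> y \<in> pS \<Longrightarrow> x + y \<in> pS"
  by (auto simp: pS_def add_mem simp flip: distrib_left)

lemma pS_uminus: "x \<in> pS \<Longrightarrow> - x \<in> pS"
  by (auto simp: pS_def uminus_mem simp flip: mult_minus_right)

lemma pS_diff: "x \<in> pS \<Longrightarrow> y \<in> pS \<Longrightarrow> x - y \<in> pS"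
  using pS_add[OF _ pS_uminus] by fastforce

lemma pS_mult: "x \<in> S \<Longrightarrow> y \<in> pS \<Longrightarrow> x * y \<in> pS"
  by (auto simp: pS_def mult.left_commute[of x] intro!: mult_mem)

lemma pS_sum: "(\<And>x. x \<in> A \<Longrightarrow> t x \<in> pS) \<Longrightarrow> sum t A \<in> pS"
  using p_mult_pS[OF zero_mem]
  by (induction A rule: infinite_finite_induct) (auto intro: pS_add)

lemma of_nat_pS: "p dvd n \<Longrightarrow> of_nat n \<in> pS"
  by (auto elim!: dvdE intro!: p_mult_pS of_nat_mem)

text \<open>Wilson's theorem puts \<open>(p - 1)! + 1\<close> into \<open>pS\<close>; dividing by
  the unit \<open>(p - 1)!\<close> gives the claim.\<close>

lemma inverse_fact_cong: "inverse (fact (p - 1)) + 1 \<in> pS"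
proof -
  have "[int (fact (p - 1)) = - 1] (mod int p)"
    using wilson_theorem[OF prime_p] by (simp add: fact_prod of_nat_prod)
  then have "int p dvd int (fact (p - 1) + 1)"
    by (simp add: cong_iff_dvd_diff add.commute)
  then have "(of_nat (fact (p - 1) + 1) :: 'a) \<in> pS"
    by (intro of_nat_pS) (simp only: int_dvd_int_iff)
  moreover have "\<not> p dvd fact (p - 1)"
    using prime_p p_gt_2 by (simp add: prime_dvd_fact_iff)
  ultimately have "inverse (of_nat (fact (p - 1))) * of_nat (fact (p - 1) + 1) \<in> pS"
    by (intro pS_mult inverse_of_nat_mem)
  then show ?thesis
    by (simp add: field_simps)
qed

text \<open>Fermat's little theorem in the form that also covers multiples of
  \<open>p\<close>.\<close>

lemma fermat_pS: "of_nat s ^ p - of_nat s \<in> pS"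
proof -
  have "[s ^ p = s] (mod p)"
  proof (cases "p dvd s")
    case True
    then show ?thesis
      using p_gt_2 by (simp add: cong_def mod_eq_0_iff_dvd dvd_power_le dvd_power_iff
          prime_dvd_power_iff prime_p)
  next
    case False
    then have "[s * s ^ (p - 1) = s * 1] (mod p)"
      by (intro cong_mult cong_refl fermat_theorem prime_p)
    then show ?thesis
      using p_gt_2 by (simp flip: power_Suc)
  qed
  \<comment> \<open>This makes the subtraction of natural numbers agree with that in the
    field.\<close>
  moreover have "s \<le> s ^ p"
    using p_gt_2 by (cases "s = 0") (auto intro: self_le_power)
  ultimately have "p dvd s ^ p - s"
    by (metis cong_altdef_nat cong_sym)
  then show ?thesis
    using \<open>s \<le> s ^ p\<close> of_nat_pS[of "s ^ p - s"] by (simp add: of_nat_diff)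
qed

end


section \<open>The power maps of the elliptic formal group\<close>

text \<open>The first-order equation \<open>ode\<close> leads to the quartic for the logarithm;
  \<open>ode2\<close>, its derivative divided by \<open>2 f'\<close>, gives a recursion for the
  coefficients of \<open>f\<close>.\<close>

locale p_integral_elliptic = p_integral S p for S :: "'a :: field_char_0 set" and p +
  fixes d e :: 'a and f :: "'a fps"
  assumes d_mem: "d \<in> S" and e_mem: "e \<in> S"
    and f0: "fps_nth f 0 = 0" and f1: "fps_nth f 1 = 1"
    and ode: "fps_deriv f ^ 2 = 1 - fps_const (2 * d) * f ^ 2 + fps_const e * f ^ 4"
    and ode2: "fps_deriv (fps_deriv f) = - fps_const (2 * d) * f + fps_const (2 * e) * f ^ 3"
begin

definition g where "g = fps_inv f"

definition w where "w = fps_deriv g"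

definition quartic :: "'a fps" where
  "quartic = 1 - fps_const (2 * d) * fps_X ^ 2 + fps_const e * fps_X ^ 4"

text \<open>The series \<open>g / u\<close>: since \<open>g^i = u^i q^i\<close>, degree
  \<open>n\<close> of \<open>g^i\<close> is degree \<open>n - i\<close> of
  \<open>q^i\<close>.\<close>

definition q where "q = fps_shift 1 g"

text \<open>The series \<open>[u]_s / u\<close>, with constant term \<open>s\<close>.\<close>

definition Q where "Q s = fps_shift 1 (f oo (of_nat s * g))"

section \<open>Integrality of the exponential \<open>f\<close>\<close>

lemma f_nth_rec:
  "of_nat ((n + 2) * (n + 1)) * fps_nth f (n + 2)
    = - (2 * d) * fps_nth f n + 2 * e * fps_nth (f ^ 3) n"
proof -
  have "fps_nth (fps_deriv (fps_deriv f)) n = - (2 * d) * fps_nth f n + 2 * e * fps_nth (f ^ 3) n"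
    unfolding ode2 by (simp del: fps_const_neg add: fps_mult_left_const_nth flip: fps_const_neg)
  then show ?thesis
    by (simp add: algebra_simps)
qed

lemma f_nth_rec_mem:
  assumes "integral_upto n f"
  shows "of_nat ((n + 2) * (n + 1)) * fps_nth f (n + 2) \<in> S"
proof -
  have "fps_nth (f ^ 3) n \<in> S" "fps_nth f n \<in> S"
    using assms integral_upto_power[OF assms, of 3] by (auto simp: integral_upto_def)
  then show ?thesis
    unfolding f_nth_rec using of_nat_mem[of 2] d_mem e_mem
    by (intro add_mem uminus_mem mult_mem) auto
qed

text \<open>The recursion gives \<open>n (n - 1)\<close> times the coefficient, and for
  \<open>2 \<le> n < p\<close> this factor is prime to \<open>p\<close>.\<close>

lemma f_mem: "n < p \<Longrightarrow> fps_nth f n \<in> S"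
proof (induction n rule: less_induct)
  case (less n)
  show ?case
  proof (cases "n < 2")
    case True
    then have "n = 0 \<or> n = 1" by auto
    then show ?thesis
      using f0 f1 zero_mem one_mem by auto
  next
    case False
    define m where "m = n - 2"
    have n: "n = m + 2" using False by (simp add: m_def)
    have "integral_upto m f"
      using less n by (auto simp: integral_upto_def)
    from f_nth_rec_mem[OF this] show ?thesis
      unfolding n using less.prems n prime_p
      by (elim of_nat_mult_mem_cancel) (simp only: prime_dvd_mult_iff, simp add: not_dvd_less)
  qed
qed

text \<open>In degree \<open>p\<close> the factor is \<open>p (p - 1)\<close>: \<open>p - 1\<close>
  can be cancelled, \<open>p\<close> stays.\<close>

lemma p_f_mem: "of_nat p * fps_nth f p \<in> S"
proof -
  define m where "m = p - 2"
  have p: "p = m + 2" using p_gt_2 by (simp add: m_def)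
  have "integral_upto m f"
    using f_mem p by (auto simp: integral_upto_def)
  from f_nth_rec_mem[OF this] have "of_nat (m + 1) * (of_nat p * fps_nth f p) \<in> S"
    unfolding p[symmetric] by (simp only: of_nat_mult mult_ac)
  then show ?thesis
    using p not_dvd_less[of "m + 1"] by (elim of_nat_mult_mem_cancel) simp
qed

section \<open>The logarithm \<open>g\<close> and its derivative \<open>w\<close>\<close>

lemma g0: "fps_nth g 0 = 0"
  by (simp add: g_def fps_inv_def)

lemma f_compose_g: "f oo g = fps_X"
  unfolding g_def using f0 f1 by (intro fps_inv_right) auto

lemma g1: "fps_nth g 1 = 1"
  using arg_cong[OF f_compose_g, of "\<lambda>h. fps_nth h 1"] f0 f1
  by (simp add: fps_compose_nth)

lemma g_eq: "g = fps_X * q"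
  using g0 by (intro fps_ext) (auto simp: q_def)

lemma w0: "fps_nth w 0 = 1"
  using g1 by (simp add: w_def)

text \<open>Substituting \<open>g\<close> into \<open>ode\<close> gives
  \<open>f'(g)^2 = quartic\<close>, and the chain rule for \<open>f(g(u)) = u\<close> makes
  \<open>w\<close> the reciprocal of \<open>f'(g)\<close>.\<close>

lemma w_quartic: "w ^ 2 * quartic = 1"
proof -
  have "fps_deriv f ^ 2 oo g = quartic"
    unfolding ode quartic_def using g0
    by (simp add: fps_compose_add_distrib fps_compose_sub_distrib fps_compose_mult_distrib f_compose_g
        flip: fps_compose_power)
  then have "(fps_deriv f oo g) ^ 2 = quartic"
    using g0 by (simp add: fps_compose_power)
  moreover have "(fps_deriv f oo g) * w = 1"
    using fps_compose_deriv[OF g0, of f] by (simp add: f_compose_g w_def)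
  ultimately show ?thesis
    by (metis mult.commute power_mult_distrib power_one)
qed

lemma w_eq: "fps_inv_sqrt quartic = w"
  using w0 w_quartic by (intro fps_inv_sqrt_eqI[where c = "1 / 2"]) (auto simp: quartic_def)

text \<open>The square of \<open>w\<close> is integral, being the inverse of a series with constant
  term 1. Its coefficient of degree \<open>n\<close> is twice that of \<open>w\<close> plus earlier
  terms, and 2 is a unit because \<open>p\<close> is odd.\<close>

lemma w_mem: "fps_nth w n \<in> S"
proof (induction n rule: less_induct)
  case (less n)
  have "w ^ 2 = inverse quartic"
    using w_quartic by (metis fps_inverse_unique mult.commute)
  moreover have "integral_upto n quartic"
    using zero_mem one_mem d_mem e_mem of_nat_mem[of 2]
    by (auto simp: integral_upto_def quartic_def fps_X_power_nth
        intro!: uminus_mem mult_mem)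
  then have "integral_upto n (inverse quartic)"
    by (rule integral_upto_inverse[rotated 2]) (simp_all add: quartic_def one_mem)
  ultimately have w2: "fps_nth (w ^ 2) n \<in> S"
    by (simp add: integral_upto_def)
  show ?case
  proof (cases "n = 0")
    case False
    then have "{0..n} = insert 0 (insert n {1..<n})"
      by auto
    then have "fps_nth (w ^ 2) n = 2 * fps_nth w n + (\<Sum>i\<in>{1..<n}. fps_nth w i * fps_nth w (n - i))"
      using False by (simp add: power2_eq_square fps_mult_nth w0)
    then have "of_nat 2 * fps_nth w n
        = fps_nth (w ^ 2) n - (\<Sum>i\<in>{1..<n}. fps_nth w i * fps_nth w (n - i))"
      by simp
    also have "\<dots> \<in> S"
      using w2 less by (intro diff_mem sum_mem mult_mem) auto
    finally show ?thesis
      using p_gt_2 by (elim of_nat_mult_mem_cancel) (simp add: not_dvd_less)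
  qed (simp add: w0 one_mem)
qed

lemma q_nth: "of_nat (n + 1) * fps_nth q n = fps_nth w n"
  by (simp add: q_def w_def)

lemma q0: "fps_nth q 0 = 1"
  using g1 by (simp add: q_def)

text \<open>By \<open>q_nth\<close> the only denominator is \<open>n + 1\<close>, which is prime to
  \<open>p\<close> in this range.\<close>

lemma q_mem: "n + 1 < p \<Longrightarrow> fps_nth q n \<in> S"
  using w_mem[of n] q_nth[of n] not_dvd_less[of "n + 1"] of_nat_mult_mem_cancel[of "n + 1" "fps_nth q n"]
  by simp

lemma q_power_mem:
  assumes "n + 1 < p"
  shows "fps_nth (q ^ i) n \<in> S"
proof -
  have "integral_upto n q"
    using q_mem assms by (auto simp: integral_upto_def)
  then show ?thesis
    using integral_upto_power by (auto simp: integral_upto_def)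
qed

section \<open>Coefficients of \<open>[u]_s / u\<close> up to degree \<open>p - 1\<close>\<close>

lemma Q_nth:
  "fps_nth (Q s) n = (\<Sum>i=1..n + 1. of_nat s ^ i * (fps_nth f i * fps_nth (q ^ i) (n + 1 - i)))"
proof -
  have "(of_nat s * g) ^ i = fps_const (of_nat s ^ i) * (fps_X ^ i * q ^ i)" for i
    by (simp add: g_eq power_mult_distrib fps_of_nat[symmetric] fps_const_power)
  then have "fps_nth ((of_nat s * g) ^ i) (n + 1)
      = of_nat s ^ i * (if n + 1 < i then 0 else fps_nth (q ^ i) (n + 1 - i))" for i
    by (simp only: fps_mult_left_const_nth fps_X_power_mult_nth)
  then have "fps_nth (Q s) n
      = (\<Sum>i=0..n + 1. fps_nth f i * (of_nat s ^ i * (if n + 1 < i then 0 else fps_nth (q ^ i) (n + 1 - i))))"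
    by (simp add: Q_def fps_compose_nth)
  \<comment> \<open>The term \<open>i = 0\<close> vanishes because \<open>f\<close> has no constant
    term.\<close>
  also have "\<dots> = (\<Sum>i=1..n + 1. of_nat s ^ i * (fps_nth f i * fps_nth (q ^ i) (n + 1 - i)))"
    using f0 by (intro sum.mono_neutral_cong_right) (auto simp: not_le)
  finally show ?thesis .
qed

lemma Q0: "fps_nth (Q s) 0 = of_nat s"
  using f1 q0 by (simp add: Q_nth)

lemma f_compose_mult_g: "f oo (of_nat s * g) = fps_X * Q s"
  using f0 by (intro fps_ext) (auto simp: Q_def)

text \<open>Both factors lie in the integral range: \<open>i < p\<close> for \<open>f\<close>, and
  \<open>n - i \<le> p - 2\<close> for the power of \<open>q\<close>.\<close>

lemma f_q_mem:
  assumes "2 \<le> i" "i \<le> n" "i < p" "n \<le> p"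
  shows "fps_nth f i * fps_nth (q ^ i) (n - i) \<in> S"
  using assms by (intro mult_mem f_mem q_power_mem) auto

text \<open>Every term carries \<open>p^i\<close> with \<open>i \<ge> 1\<close>, and below degree
  \<open>p - 1\<close> the other factors are integral.\<close>

lemma Q_p_low: "n < p - 1 \<Longrightarrow> fps_nth (Q p) n \<in> pS"
proof -
  assume n: "n < p - 1"
  have "of_nat p ^ i * (fps_nth f i * fps_nth (q ^ i) (n + 1 - i)) \<in> pS" if "i \<in> {1..n + 1}" for i
  proof -
    have "of_nat p ^ i \<in> pS"
      using that of_nat_pS[of "p ^ i"] by (simp add: dvd_power)
    moreover have "fps_nth f i * fps_nth (q ^ i) (n + 1 - i) \<in> S"
      using that n by (intro mult_mem f_mem q_power_mem) auto
    ultimately show ?thesis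
      by (metis mult.commute pS_mult)
  qed
  then show ?thesis
    unfolding Q_nth by (intro pS_sum)
qed

lemma Q_low: "n < p - 1 \<Longrightarrow> fps_nth (Q s) n \<in> S"
  unfolding Q_nth
  by (intro sum_mem mult_mem f_mem q_power_mem power_mem of_nat_mem) auto

text \<open>Isolates the two terms in which \<open>p\<close> may occur in a denominator:
  \<open>i = 1\<close> with the coefficient of \<open>g\<close> of degree \<open>p\<close>, and
  \<open>i = p\<close> with that of \<open>f\<close>.\<close>

lemma Q_top:
  "fps_nth (Q s) (p - 1) = of_nat s * fps_nth q (p - 1)
    + (\<Sum>i\<in>{2..<p}. of_nat s ^ i * (fps_nth f i * fps_nth (q ^ i) (p - i)))
    + of_nat s ^ p * fps_nth f p"
proof -
  have "{1..p} = insert 1 (insert p {2..<p})"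
    using p_gt_2 by auto
  then show ?thesis
    using p_gt_2 f1 q0 by (simp add: Q_nth fps_nth_power_0 algebra_simps)
qed

text \<open>For \<open>s = p\<close> the term \<open>i = 1\<close> equals the coefficient of
  \<open>w\<close> by \<open>q_nth\<close>, and all others are divisible by
  \<open>p\<close>.\<close>

lemma Q_p_top: "fps_nth (Q p) (p - 1) - fps_nth w (p - 1) \<in> pS"
proof -
  have pi: "of_nat p ^ i \<in> pS" if "i > 0" for i
    using that of_nat_pS[of "p ^ i"] by (simp add: dvd_power)
  have "of_nat p ^ i * (fps_nth f i * fps_nth (q ^ i) (p - i)) \<in> pS" if "i \<in> {2..<p}" for i
    using that f_q_mem[of i p] pi[of i] by (subst mult.commute) (auto intro!: pS_mult)
  moreover have "of_nat p ^ p * fps_nth f p \<in> pS"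
  proof -
    \<comment> \<open>One factor \<open>p\<close> clears the denominator of \<open>f\<close>; at
      least one more is left because \<open>p > 1\<close>.\<close>
    have "of_nat p ^ p * fps_nth f p = (of_nat p * fps_nth f p) * of_nat p ^ (p - 1)"
      using p_gt_2 power_minus_mult[of p "of_nat p :: 'a"]
      by (metis mult.assoc mult.commute zero_less_numeral less_trans)
    then show ?thesis
      using pS_mult[OF p_f_mem pi[of "p - 1"]] p_gt_2
      by (metis zero_less_diff less_trans one_less_numeral_iff semiring_norm(76))
  qed
  moreover have "of_nat p * fps_nth q (p - 1) = fps_nth w (p - 1)"
    using q_nth[of "p - 1"] p_gt_2 by simp
  ultimately show ?thesis
    unfolding Q_top by (auto intro!: pS_add pS_sum)
qed

text \<open>Since \<open>[u]_1 = u\<close>, the coefficient in \<open>Q_top\<close> vanishes for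
  \<open>s = 1\<close>, and the middle terms are integral.\<close>

lemma g_nth_p_add_f_nth_p_mem: "fps_nth q (p - 1) + fps_nth f p \<in> S"
proof -
  have "fps_nth (Q 1) (p - 1) = 0"
    using p_gt_2 by (simp add: Q_def f_compose_g)
  then have "fps_nth q (p - 1) + fps_nth f p
      = - (\<Sum>i\<in>{2..<p}. fps_nth f i * fps_nth (q ^ i) (p - i))"
    unfolding Q_top by (simp add: eq_neg_iff_add_eq_0 add_ac)
  also have "\<dots> \<in> S"
    by (intro uminus_mem sum_mem f_q_mem) auto
  finally show ?thesis .
qed

text \<open>
  Neither the logarithm nor the exponential is integral in degree \<open>p\<close>: the denominators of
  \<open>s g\<^sub>p\<close> and \<open>s\<^sup>p f\<^sub>p\<close> cancel by Fermat's little theorem.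
\<close>

lemma Q_top_mem: "fps_nth (Q s) (p - 1) \<in> S"
proof -
  obtain z where z: "of_nat s ^ p - of_nat s = of_nat p * z" "z \<in> S"
    using fermat_pS[of s] by (auto simp: pS_def)
  have "of_nat s * fps_nth q (p - 1) + of_nat s ^ p * fps_nth f p
      = of_nat s * (fps_nth q (p - 1) + fps_nth f p) + (of_nat s ^ p - of_nat s) * fps_nth f p"
    by (simp add: algebra_simps)
  also have "\<dots> = of_nat s * (fps_nth q (p - 1) + fps_nth f p) + z * (of_nat p * fps_nth f p)"
    by (simp add: z mult_ac)
  also have "\<dots> \<in> S"
    by (intro add_mem mult_mem of_nat_mem g_nth_p_add_f_nth_p_mem p_f_mem z)
  finally have "of_nat s * fps_nth q (p - 1) + of_nat s ^ p * fps_nth f p \<in> S" .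
  moreover have "(\<Sum>i\<in>{2..<p}. of_nat s ^ i * (fps_nth f i * fps_nth (q ^ i) (p - i))) \<in> S"
    by (intro sum_mem mult_mem[OF power_mem[OF of_nat_mem]] f_q_mem) auto
  ultimately have "(of_nat s * fps_nth q (p - 1) + of_nat s ^ p * fps_nth f p)
      + (\<Sum>i\<in>{2..<p}. of_nat s ^ i * (fps_nth f i * fps_nth (q ^ i) (p - i))) \<in> S"
    by (rule add_mem)
  then show ?thesis
    unfolding Q_top by (simp only: ac_simps)
qed

lemma Q_integral: "integral_upto (p - 1) (Q s)"
  using Q_low Q_top_mem by (auto simp: integral_upto_def le_less)

section \<open>Inverting \<open>[u]_p\<close> and the congruence for the quotient\<close>

lemma inverse_Q_p:
  defines "E \<equiv> inverse (fps_const (1 / of_nat p) * Q p)"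
  shows "n < p - 1 \<Longrightarrow> fps_nth E n \<in> S"
    and "of_nat p * fps_nth E (p - 1) + fps_nth w (p - 1) \<in> pS"
proof -
  \<comment> \<open>Dividing by \<open>p\<close> makes the constant term 1 and keeps the
    coefficients below degree \<open>p - 1\<close> integral, so the inverse \<open>E\<close> is
    integral there too.\<close>
  define A where "A = fps_const (1 / of_nat p) * Q p"
  have pA: "of_nat p * fps_nth A i = fps_nth (Q p) i" for i
    using p_gt_2 by (simp add: A_def)
  have A0: "fps_nth A 0 = 1"
    using p_gt_2 by (simp add: A_def Q0)
  have A: "fps_nth A i \<in> S" if i: "i < p - 1" for i
  proof -
    obtain z where "fps_nth (Q p) i = of_nat p * z" "z \<in> S"
      using Q_p_low[OF i] by (auto simp: pS_def)
    then show ?thesis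
      using pA[of i] p_gt_2 by simp
  qed
  then have "integral_upto (p - 2) A"
    using p_gt_2 by (auto simp: integral_upto_def)
  then have "integral_upto (p - 2) E"
    unfolding E_def A_def[symmetric] using A0 one_mem by (intro integral_upto_inverse) simp_all
  then show E: "fps_nth E n \<in> S" if "n < p - 1" for n
    using that by (auto simp: integral_upto_def)
  \<comment> \<open>The term \<open>i = p - 1\<close> is the only one that may fail to be integral;
    it is paired with the constant term 1 of \<open>E\<close>.\<close>
  have "{1..p - 1} = insert (p - 1) {1..<p - 1}"
    using p_gt_2 by auto
  then have "fps_nth E (p - 1) = - (fps_nth A (p - 1) + (\<Sum>i\<in>{1..<p - 1}. fps_nth A i * fps_nth E (p - 1 - i)))"
    unfolding E_def A_def[symmetric] using p_gt_2 A0 by (subst fps_inverse_nth_rec) simp_all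
  then have "of_nat p * fps_nth E (p - 1) = - (fps_nth (Q p) (p - 1))
      - of_nat p * (\<Sum>i\<in>{1..<p - 1}. fps_nth A i * fps_nth E (p - 1 - i))"
    by (simp only: minus_add_distrib distrib_left right_diff_distrib mult_minus_right pA
        flip: diff_conv_add_uminus)
  then have "of_nat p * fps_nth E (p - 1) + fps_nth w (p - 1)
     = - (fps_nth (Q p) (p - 1) - fps_nth w (p - 1))
       - of_nat p * (\<Sum>i\<in>{1..<p - 1}. fps_nth A i * fps_nth E (p - 1 - i))"
    by (simp add: algebra_simps)
  also have "\<dots> \<in> pS"
    by (intro pS_diff pS_uminus Q_p_top p_mult_pS sum_mem mult_mem A E) auto
  finally show "of_nat p * fps_nth E (p - 1) + fps_nth w (p - 1) \<in> pS" .
qed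

text \<open>Taking one \<open>u\<close> out of each of the \<open>p\<close> factors cancels
  \<open>u^p\<close> and leaves \<open>p C E\<close>, where \<open>C\<close> inverts the product of
  \<open>Q s\<close> for \<open>2 \<le> s < p\<close>. In degree \<open>p - 1\<close> only the
  product of \<open>fps_nth C 0\<close> and \<open>fps_nth E (p - 1)\<close> survives modulo
  \<open>p\<close>; the two signs, from Wilson's theorem and from \<open>inverse_Q_p\<close>,
  cancel.\<close>

theorem quotient_cong:
  "fps_nth (of_nat p ^ 2 * fps_X ^ p / (fps_X * (\<Prod>s = 2..p. f oo (of_nat s * fps_inv f)))) (p - 1)
    - fps_nth (fps_inv_sqrt quartic) (p - 1) \<in> pS"
proof -
  define B where "B = (\<Prod>s\<in>{2..<p}. Q s)"
  define C where "C = inverse B"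
  define E where "E = inverse (fps_const (1 / of_nat p) * Q p)"
  have B0: "fps_nth B 0 = of_nat (fact (p - 1))"
  proof -
    have "fps_nth B 0 = of_nat (\<Prod>{2..<p})"
      unfolding B_def by (simp add: fps_prod_nth_0 Q0)
    also have "\<Prod>{2..<p} = fact (p - 1)"
    proof -
      have "{1..p - 1} = insert 1 {2..<p}"
        using p_gt_2 by auto
      then show ?thesis
        by (simp add: fact_prod)
    qed
    finally show ?thesis .
  qed
  have fact: "\<not> p dvd fact (p - 1)"
    using prime_p p_gt_2 by (simp add: prime_dvd_fact_iff)
  have "integral_upto (p - 1) C"
    unfolding C_def using inverse_of_nat_mem[OF fact] B0
    by (intro integral_upto_inverse) (simp_all add: B_def integral_upto_prod Q_integral[simplified])
  then have C: "fps_nth C i \<in> S" if "i \<le> p - 1" for i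
    using that by (auto simp: integral_upto_def)
  have C0: "fps_nth C 0 + 1 \<in> pS" "fps_nth C 0 \<in> S"
    using inverse_fact_cong C[of 0] by (simp_all add: C_def B0)
  have "(\<Prod>s = 2..p. f oo (of_nat s * fps_inv f)) = (\<Prod>s = 2..p. fps_X * Q s)"
    by (simp flip: g_def add: f_compose_mult_g)
  also have "\<dots> = fps_X ^ (p - 1) * (\<Prod>s = 2..p. Q s)"
    using p_gt_2 by (simp add: prod.distrib numeral_2_eq_2)
  also have "{2..p} = insert p {2..<p}"
    using p_gt_2 by auto
  then have "(\<Prod>s = 2..p. Q s) = Q p * B"
    by (simp add: B_def)
  finally have prod: "fps_X * (\<Prod>s = 2..p. f oo (of_nat s * fps_inv f)) = (Q p * B) * fps_X ^ p"
    using p_gt_2 power_Suc[of "fps_X :: 'a fps" "p - 1"] by (simp add: mult_ac)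
  have QB0: "fps_nth (Q p * B) 0 \<noteq> 0"
    using p_gt_2 by (simp add: Q0 B0)
  have "of_nat p ^ 2 * fps_X ^ p / (fps_X * (\<Prod>s = 2..p. f oo (of_nat s * fps_inv f)))
      = of_nat p ^ 2 / (Q p * B)"
    unfolding prod using QB0 by (subst div_mult_mult2) auto
  also have "\<dots> = of_nat p ^ 2 * (inverse (Q p) * C)"
    by (simp only: fps_divide_unit[OF QB0] fps_inverse_mult C_def)
  also have "inverse (Q p) = fps_const (1 / of_nat p) * E"
    unfolding E_def using p_gt_2 by (simp add: fps_inverse_mult fps_const_inverse flip: mult.assoc)
  also have "of_nat p ^ 2 * (fps_const (1 / of_nat p) * E * C)
      = (of_nat p ^ 2 * fps_const (1 / of_nat p)) * (C * E)"
    by (simp only: mult_ac)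
  also have "of_nat p ^ 2 * fps_const (1 / of_nat p) = fps_const (of_nat p :: 'a)"
    using p_gt_2 by (simp add: power2_eq_square flip: fps_of_nat)
  finally have "fps_nth (of_nat p ^ 2 * fps_X ^ p / (fps_X * (\<Prod>s = 2..p. f oo (of_nat s * fps_inv f)))) (p - 1)
      = of_nat p * fps_nth (C * E) (p - 1)"
    by simp
  also have "{0..p - 1} = insert 0 {1..p - 1}"
    by auto
  then have "fps_nth (C * E) (p - 1)
      = fps_nth C 0 * fps_nth E (p - 1) + (\<Sum>i = 1..p - 1. fps_nth C i * fps_nth E (p - 1 - i))"
    by (simp add: fps_mult_nth)
  \<comment> \<open>Adding and subtracting \<open>fps_nth C 0 * fps_nth w (p - 1)\<close> splits the
    difference into three summands, each in \<open>pS\<close>.\<close>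
  finally have "fps_nth (of_nat p ^ 2 * fps_X ^ p / (fps_X * (\<Prod>s = 2..p. f oo (of_nat s * fps_inv f)))) (p - 1)
      - fps_nth w (p - 1)
      = fps_nth C 0 * (of_nat p * fps_nth E (p - 1) + fps_nth w (p - 1))
        - fps_nth w (p - 1) * (fps_nth C 0 + 1)
        + of_nat p * (\<Sum>i = 1..p - 1. fps_nth C i * fps_nth E (p - 1 - i))"
    by (simp add: algebra_simps)
  also have "\<dots> \<in> pS"
    unfolding E_def
    by (intro pS_add pS_diff pS_mult p_mult_pS sum_mem mult_mem inverse_Q_p C C0 w_mem) auto
  finally show ?thesis
    by (simp add: w_eq)
qed

end


section \<open>Polynomials with p-integral coefficients\<close>

text \<open>The localisation of the integers at \<open>p\<close>; fractions need not be reduced,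
  which eases closure under sums and products.\<close>

definition p_integral_rats :: "nat \<Rightarrow> rat set" where
  "p_integral_rats p = {of_int a / of_int b | a b. \<not> int p dvd b}"

lemma p_integral_ratsI: "\<not> int p dvd b \<Longrightarrow> of_int a / of_int b \<in> p_integral_rats p"
  by (auto simp: p_integral_rats_def)

lemma subring_set_p_integral_rats:
  assumes "prime p"
  shows "subring_set (p_integral_rats p)"
proof
  have p: "prime (int p)"
    using assms by simp
  show "1 \<in> p_integral_rats p"
    using p_integral_ratsI[of p 1 1] assms by (auto simp: prime_nat_iff)
  fix x y
  assume "x \<in> p_integral_rats p"
  then obtain a b where x: "x = of_int a / of_int b" "\<not> int p dvd b"
    by (auto simp: p_integral_rats_def)
  show "- x \<in> p_integral_rats p"
    using p_integral_ratsI[of p b "- a"] x by simp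
  assume "y \<in> p_integral_rats p"
  then obtain a' b' where y: "y = of_int a' / of_int b'" "\<not> int p dvd b'"
    by (auto simp: p_integral_rats_def)
  have bb: "\<not> int p dvd b * b'"
    using x y p by (simp add: prime_dvd_mult_iff)
  have nz: "b \<noteq> 0" "b' \<noteq> 0"
    using x y by auto
  show "x * y \<in> p_integral_rats p"
    using p_integral_ratsI[OF bb, of "a * a'"] x y by simp
  have "x + y = of_int (a * b' + a' * b) / of_int (b * b')"
    using x y nz by (simp add: field_simps)
  then show "x + y \<in> p_integral_rats p"
    using p_integral_ratsI[OF bb] by metis
qed

text \<open>The nested set lets \<open>subring_set_poly\<close> be applied once for each
  indeterminate.\<close>

definition p_integral_polys :: "nat \<Rightarrow> rat poly poly set" where
  "p_integral_polys p = {d. \<forall>i. coeff d i \<in> {c. \<forall>j. coeff c j \<in> p_integral_rats p}}"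

lemma subring_set_p_integral_polys:
  "prime p \<Longrightarrow> subring_set (p_integral_polys p)"
  unfolding p_integral_polys_def
  by (intro subring_set.subring_set_poly subring_set_p_integral_rats)

lemma p_integral_fract_polys:
  assumes "prime p" "odd p"
  shows "p_integral (to_fract ` p_integral_polys p) p"
proof -
  interpret R: subring_set "p_integral_rats p"
    by (rule subring_set_p_integral_rats) fact
  interpret subring_set "to_fract ` p_integral_polys p"
    using assms by (intro subring_set.subring_set_image subring_set_p_integral_polys
        comm_ring_hom_fun_to_fract)
  show ?thesis
  proof
    fix n
    assume n: "\<not> p dvd n"
    then have "n \<noteq> 0"
      by (metis dvd_0_right)
    \<comment> \<open>The inverse of \<open>n\<close> is a constant polynomial, so it lies in the
      image of the polynomial ring.\<close>
    let ?c = "[:[:1 / of_nat n:]:] :: rat poly poly"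
    have "of_nat n * ?c = 1"
      using \<open>n \<noteq> 0\<close> by (simp add: of_nat_poly one_pCons)
    then have "of_nat n * to_fract ?c = 1"
      using comm_ring_hom_fun.hom_of_nat[OF comm_ring_hom_fun_to_fract, of n]
      by (metis to_fract_1 to_fract_mult)
    then have "inverse (of_nat n) = to_fract ?c"
      by (metis inverse_unique)
    moreover have "?c \<in> p_integral_polys p"
      using p_integral_ratsI[of p "int n" 1] n R.zero_mem
      by (auto simp: p_integral_polys_def coeff_pCons split: nat.split)
    ultimately show "inverse (of_nat n) \<in> to_fract ` p_integral_polys p"
      by simp
  qed (use assms in auto)
qed

text \<open>Identifies the \<open>p\<close>-adic form of the congruence with the ideal
  \<open>pS\<close>: by \<open>p_padic_rats_iff\<close>, a rational lies in \<open>p\<close> times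
  the \<open>p\<close>-adic integers iff its quotient by \<open>p\<close> lies in the
  localisation.\<close>

lemma p_padic_polys_eq:
  assumes "prime p"
  shows "p_padic_polys p = (*) (of_nat p) ` to_fract ` p_integral_polys p"
proof -
  have p: "p \<noteq> 0"
    using assms by auto
  have 1: "c \<in> p_padic_rats p \<longleftrightarrow> c / of_nat p \<in> p_integral_rats p" for c
    using p unfolding p_padic_rats_iff[OF assms] p_integral_rats_def
    by (simp add: field_simps) (metis mult.commute)
  have of_nat_p: "of_nat p * to_fract x = to_fract (of_nat p * x)" for x :: "rat poly poly"
    by (simp add: comm_ring_hom_fun.hom_of_nat[OF comm_ring_hom_fun_to_fract])
  have to_fract_p: "(*) (of_nat p) ` to_fract ` D = to_fract ` (*) (of_nat p) ` D"
    for D :: "rat poly poly set"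
    unfolding image_image of_nat_p ..
  have "{d. \<forall>i j. coeff (coeff d i) j \<in> p_padic_rats p} = (*) (of_nat p) ` p_integral_polys p"
  proof (intro equalityI subsetI)
    fix d
    assume "d \<in> {d. \<forall>i j. coeff (coeff d i) j \<in> p_padic_rats p}"
    then have "smult [:1 / of_nat p:] d \<in> p_integral_polys p"
      by (simp add: p_integral_polys_def 1)
    moreover have "of_nat p * smult [:1 / of_nat p:] d = d"
      using p by (simp add: of_nat_poly one_pCons[symmetric])
    ultimately show "d \<in> (*) (of_nat p) ` p_integral_polys p"
      by (metis image_eqI)
  next
    fix d
    assume "d \<in> (*) (of_nat p) ` p_integral_polys p"
    then show "d \<in> {d. \<forall>i j. coeff (coeff d i) j \<in> p_padic_rats p}"
      using p by (auto simp: p_integral_polys_def 1 of_nat_poly)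
  qed
  then show ?thesis
    unfolding p_padic_polys_def to_fract_p by blast
qed

lemma fps_to_fract_eq: "fps_to_fract = fps_map to_fract"
  by (auto simp: fps_to_fract_def fps_map_def)

text \<open>Both differential equations are carried to the fraction field coefficientwise, the
  second one from \<open>ell_f_second_order\<close>.\<close>

lemma p_integral_elliptic_ell_f:
  assumes "prime p" "odd p"
  shows "p_integral_elliptic (to_fract ` p_integral_polys p) p (to_fract delta) (to_fract epsilon)
    (fps_to_fract ell_f)"
proof -
  interpret p_integral "to_fract ` p_integral_polys p" p
    using assms by (rule p_integral_fract_polys)
  interpret R: subring_set "p_integral_rats p"
    by (rule subring_set_p_integral_rats) fact
  interpret h: comm_ring_hom_fun "to_fract :: rat poly poly \<Rightarrow> _"
    by (rule comm_ring_hom_fun_to_fract)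
  have 0: "fps_nth ell_f 0 = 0" and 1: "fps_nth ell_f 1 = 1" and ode:
    "fps_deriv ell_f ^ 2 = 1 - fps_const (2 * delta) * ell_f ^ 2 + fps_const epsilon * ell_f ^ 4"
    using theI'[OF ell_f_ex1] unfolding ell_f_def[symmetric] by auto
  have two: "to_fract (2 :: rat poly poly) = 2"
    using h.hom_of_nat[of 2] by simp
  have mem: "to_fract delta \<in> to_fract ` p_integral_polys p"
    "to_fract epsilon \<in> to_fract ` p_integral_polys p"
    using R.zero_mem R.one_mem
    by (auto simp: delta_def epsilon_def p_integral_polys_def coeff_pCons one_pCons split: nat.split)
  show ?thesis
  proof
    show "fps_deriv (fps_to_fract ell_f) ^ 2 = 1 - fps_const (2 * to_fract delta) * fps_to_fract ell_f ^ 2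
        + fps_const (to_fract epsilon) * fps_to_fract ell_f ^ 4"
      using arg_cong[OF ode, of fps_to_fract] by (simp add: fps_to_fract_eq h.fps_map_simps two)
    have "fps_deriv (fps_deriv ell_f) = fps_const (2 * epsilon) * ell_f ^ 3 - fps_const (2 * delta) * ell_f"
      unfolding ell_f_second_order[OF 1 ode] by (simp flip: fps_const_neg)
    from arg_cong[OF this, of fps_to_fract]
    have "fps_deriv (fps_deriv (fps_to_fract ell_f)) = fps_const (2 * to_fract epsilon) * fps_to_fract ell_f ^ 3
        - fps_const (2 * to_fract delta) * fps_to_fract ell_f"
      by (simp add: fps_to_fract_eq h.fps_map_simps two)
    then show "fps_deriv (fps_deriv (fps_to_fract ell_f)) = - fps_const (2 * to_fract delta) * fps_to_fract ell_f
        + fps_const (2 * to_fract epsilon) * fps_to_fract ell_f ^ 3"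
      by (simp flip: fps_const_neg)
  qed (use 0 1 mem in \<open>simp_all add: fps_to_fract_eq\<close>)
qed

theorem mainTheorem6:
  fixes p :: nat and k :: "rat poly poly fract alg_closure"
  assumes "prime p" and "odd p"
    and "k ^ 2 = to_ac (to_fract epsilon)"
  shows "let lhs = fps_nth (of_nat p ^ 2 * fps_X ^ p
                     / (fps_X * (\<Prod>s = 2..p. ell_power s))) (p - 1);
             rhs = fps_nth (fps_inv_sqrt (1 - fps_const (2 * to_fract delta) * fps_X ^ 2
                     + fps_const (to_fract epsilon) * fps_X ^ 4)) (p - 1)
         in lhs - rhs \<in> p_padic_polys p \<and>
            to_ac rhs = k ^ ((p - 1) div 2) *
              poly (map_poly of_rat (legendre ((p - 1) div 2))) (to_ac (to_fract delta) / k)"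
proof -
  interpret p_integral_elliptic "to_fract ` p_integral_polys p" p "to_fract delta" "to_fract epsilon"
    "fps_to_fract ell_f"
    using assms(1,2) by (rule p_integral_elliptic_ell_f)
  interpret h: comm_ring_hom_fun "to_ac :: rat poly poly fract \<Rightarrow> _"
    by (rule comm_ring_hom_fun_to_ac)
  define m where "m = (p - 1) div 2"
  \<comment> \<open>As \<open>p\<close> is odd, the degree is even, as
    \<open>fps_inv_sqrt_quartic_nth\<close> requires.\<close>
  have m: "p - 1 = 2 * m"
    using assms(2) by (auto simp: m_def elim: oddE)
  have "k \<noteq> 0"
    using assms(3) by (auto simp: epsilon_def)
  \<comment> \<open>The coefficient is computed over the algebraic closure, where the square root
    \<open>k\<close> of \<open>epsilon\<close> lives.\<close>
  have "to_ac (fps_nth (fps_inv_sqrt quartic) (2 * m)) = fps_nth (fps_inv_sqrt (fps_map to_ac quartic)) (2 * m)"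
    by (subst fps_map_inv_sqrt[OF comm_ring_hom_fun_to_ac, of "1 / 2", symmetric]) (simp_all add: quartic_def)
  also have "fps_map to_ac quartic = 1 - fps_const (2 * to_ac (to_fract delta)) * fps_X ^ 2 + fps_const (k ^ 2) * fps_X ^ 4"
    by (simp add: quartic_def h.fps_map_simps assms(3))
  also note fps_inv_sqrt_quartic_nth[OF \<open>k \<noteq> 0\<close>]
  finally show ?thesis
    using quotient_cong p_padic_polys_eq[OF assms(1)] m
    unfolding quartic_def[symmetric] Let_def ell_power_def pS_def m_def[symmetric] by simp
qed

end
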